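(* Let $D=(\mathcal L,\mathcal R,\mathcal A,\overline{\phantom{a}})$ be an (arbitrary, possibly non-flat) ABA framework and let $\mathbb F_D=(\mathcal F_D,\pi)$, with argument set $A$, be the instantiated premise-augmented BAF of $D$. Then for any $\sigma\in\{\mathit{ad},\mathit{co},\mathit{pr},\mathit{gr},\mathit{stb}\}$: (i) if $E\in\sigma(\mathbb F_D)$, then $\mathit{asms}(E)\in\sigma(D)$; (ii) if $S\in\sigma(D)$, then $\{x\in A\mid\mathit{asms}(x)\subseteq S\}\in\sigma(\mathbb F_D)$.
   Context: ABA frameworks. An ABA framework (ABAF) is a tuple $D=(\mathcal L,\mathcal R,\mathcal A,\overline{\phantom{a}})$ where $\mathcal L$ is a set of sentences, $\mathcal R$ is a set of rules $a_0\leftarrow a_1,\dots,a_n$ ($n\ge 0$, $a_i\in\mathcal L$; head $a_0$, body $\{a_1,\dots,a_n\}$), $\mathcal A\subseteq\mathcal L$ is a non-empty set of assumptions, and $\overline{\phantom{a}}:\mathcal A\to\mathcal L$ is a total contrary function. Assumptions may occur as heads of rules. For $S\subseteq\mathcal A$ and $p\in\mathcal L$, write $S\vdash p$ if there is a finite rooted labelled tree with root labelled $p$, whose set of leaf labels is $S$ or $S\cup\{\top\}$ (with $\top\notin\mathcal L$), such that for each inner node $v$ there is a rule $r\in\mathcal R$ with $v$ labelled by the head of $r$ and the children of $v$ labelled bijectively by the body of $r$ (a single child labelled $\top$ if the body is empty). In particular $\{a\}\vdash a$ for each $a\in\mathcal A$. $\mathit{Th}_D(S)=\{p\mid\exists S'\subseteq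 S: S'\vdash p\}$ and $\mathit{cl}(S)=\mathit{Th}_D(S)\cap\mathcal A$; $S$ is closed if $S=\mathit{cl}(S)$. $S\subseteq\mathcal A$ attacks $T\subseteq\mathcal A$ if $\overline a\in\mathit{Th}_D(S)$ for some $a\in T$; $S$ attacks $a$ if it attacks $\{a\}$; $S$ is conflict-free if it does not attack itself. $S$ defends $a\in\mathcal A$ if $S$ attacks every closed set $T\subseteq\mathcal A$ that attacks $a$; $S$ defends itself if it defends each of its elements, and defends a set if it defends each element. ABA semantics. For conflict-free $S\subseteq\mathcal A$: $S\in\mathit{ad}(D)$ iff $S$ is closed and defends itself; $S\in\mathit{pr}(D)$ iff $S$ is $\subseteq$-maximal in $\mathit{ad}(D)$; $S\in\mathit{co}(D)$ iff $S\in\mathit{ad}(D)$ and $S$ is a superset of every assumption set it defends; $S\in\mathit{gr}(D)$ iff $S=\bigcap_{T\in\mathit{co}(D)}T$; $S\in\mathit{stb}(D)$ iff $S$ is closed and attacks each $x\in\mathcal A\setminus S$. Convention: if $\mathit{co}(D)=\emptyset$ then $\mathit{gr}(D)=\emptyset$ (there is no grounded extension). BAFs. A bipolar argumentation framework (BAF) is $\mathcal F=(A,\mathrm{Att},\mathrm{Sup})$ with $\mathrm{Att},\mathrm{Sup}\subseteq A\times A$. For $E\subseteq A$, $\mathit{cl}(E)$ is the set of arguments reachable from $E$ by zero or more support edges; $E$ is closed if $E=\mathit{cl}(E)$. $E$ attacks $a$ if $(e,a)\in\mathrm{Att}$ for some $e\in E$, and attacks a set if it attacks some element of it; $E^+$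 is the set of arguments attacked by $E$. $E$ is conflict-free if $E\cap E^+=\emptyset$. $E$ defends $a$ if $E$ attacks each closed set $S\subseteq A$ which attacks $a$; $\Gamma(E)=\{a\in A\mid E\text{ defends }a\}$. $E\in\mathit{ad}(\mathcal F)$ iff $E$ is conflict-free, closed and $E\subseteq\Gamma(E)$. Premise-augmented BAFs. A pBAF is $\mathbb F=(\mathcal F,\pi)$ with $\mathcal F=(A,\mathrm{Att},\mathrm{Sup})$ a BAF and $\pi:A\to 2^{\mathcal P}$ for a set $\mathcal P$ of premises; $\pi(E)=\bigcup_{a\in E}\pi(a)$. Conflict-freeness, closedness, attack, defense, $\Gamma$ are those of $\mathcal F$. $E\subseteq A$ is exhaustive iff for all $a\in A$, $\pi(a)\subseteq\pi(E)$ implies $a\in E$. For conflict-free $E$: $E\in\mathit{ad}(\mathbb F)$ iff $E$ is exhaustive and $E\in\mathit{ad}(\mathcal F)$; $E\in\mathit{pr}(\mathbb F)$ iff $E$ is $\subseteq$-maximal in $\mathit{ad}(\mathbb F)$; $E\in\mathit{co}(\mathbb F)$ iff $E\in\mathit{ad}(\mathbb F)$ and $E=\Gamma(E)$; $E\in\mathit{gr}(\mathbb F)$ iff $E=\bigcap_{S\in\mathit{co}(\mathbb F)}S$ (with $\mathit{gr}(\mathbb F)=\emptyset$ if $\mathit{co}(\mathbb F)=\emptyset$); $E\in\mathit{stb}(\mathbb F)$ iff $E$ is closed and $E^+=A\setminus E$. Instantiation. $\mathcal F_D=(A,\mathrm{Att},\mathrm{Sup})$ where $A$ is the set of all arguments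 $S\vdash p$ of $D$ (identified by assumption set $S$ and conclusion $p$), $\mathrm{Att}=\{(S\vdash p,\,T\vdash q)\in A^2\mid p\in\{\overline a\mid a\in T\}\}$, and $\mathrm{Sup}=\{(S\vdash p,\,\{a\}\vdash a)\in A^2\mid a\in\mathit{cl}(S)\}$. $\mathit{asms}(S\vdash p)=S$ and $\mathit{asms}(E)=\bigcup_{x\in E}\mathit{asms}(x)$. The instantiated pBAF is $\mathbb F_D=(\mathcal F_D,\pi)$ with $\pi(x)=\mathit{asms}(x)$ for all $x\in A$. *)

theory Defs
  imports Main
begin

section \<open>Assumption-based argumentation frameworks\<close>

datatype 'a rule = Rule (head: 'a) (body: "'a set")

record 'a abaf =
  sentences :: "'a set"
  rules :: "'a rule set"
  assumptions :: "'a set"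
  contrary :: "'a \<Rightarrow> 'a"

text \<open>The contrary is a map on assumptions only: its values elsewhere are irrelevant, and
  no definition below evaluates it outside \<open>assumptions D\<close>.\<close>

definition aba_framework :: "'a abaf \<Rightarrow> bool" where
  "aba_framework D \<longleftrightarrow>
     (\<forall>r\<in>rules D. head r \<in> sentences D \<and> finite (body r) \<and> body r \<subseteq> sentences D) \<and>
     assumptions D \<subseteq> sentences D \<and> assumptions D \<noteq> {} \<and>
     contrary D ` assumptions D \<subseteq> sentences D"

text \<open>Finite derivation trees. A node is labelled by a sentence \<open>Some p\<close> or by \<open>None\<close>, which
  plays the role of \<open>\<top>\<close> and so lies outside the language by construction. The order of the
  children is immaterial.\<close>

datatype 'a dtree = Node (label: "'a option") (children: "'a dtree list")

fun leaf_labels :: "'a dtree \<Rightarrow> 'a option set" where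
  "leaf_labels (Node l ts) = (if ts = [] then {l} else (\<Union>t\<in>set ts. leaf_labels t))"

fun respects_rules :: "'a rule set \<Rightarrow> 'a dtree \<Rightarrow> bool" where
  "respects_rules R (Node l ts) \<longleftrightarrow>
     (ts \<noteq> [] \<longrightarrow>
        (\<exists>r\<in>R. l = Some (head r) \<and> distinct (map label ts) \<and>
           set (map label ts) = (if body r = {} then {None} else Some ` body r))) \<and>
     (\<forall>t\<in>set ts. respects_rules R t)"

definition derives :: "'a abaf \<Rightarrow> 'a set \<Rightarrow> 'a \<Rightarrow> bool" where
  "derives D S p \<longleftrightarrow> S \<subseteq> assumptions D \<and> p \<in> sentences D \<and>
     (\<exists>t. label t = Some p \<and> respects_rules (rules D) t \<and>
        (leaf_labels t = Some ` S \<or> leaf_labels t = Some ` S \<union> {None}))"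

definition Th :: "'a abaf \<Rightarrow> 'a set \<Rightarrow> 'a set" where
  "Th D S = {p. \<exists>S'\<subseteq>S. derives D S' p}"

definition aba_cl :: "'a abaf \<Rightarrow> 'a set \<Rightarrow> 'a set" where
  "aba_cl D S = Th D S \<inter> assumptions D"

definition aba_closed :: "'a abaf \<Rightarrow> 'a set \<Rightarrow> bool" where
  "aba_closed D S \<longleftrightarrow> S = aba_cl D S"

definition aba_attacks :: "'a abaf \<Rightarrow> 'a set \<Rightarrow> 'a set \<Rightarrow> bool" where
  "aba_attacks D S T \<longleftrightarrow> (\<exists>a\<in>T. contrary D a \<in> Th D S)"

definition aba_conflict_free :: "'a abaf \<Rightarrow> 'a set \<Rightarrow> bool" where
  "aba_conflict_free D S \<longleftrightarrow> \<not> aba_attacks D S S"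

definition aba_defends :: "'a abaf \<Rightarrow> 'a set \<Rightarrow> 'a \<Rightarrow> bool" where
  "aba_defends D S a \<longleftrightarrow>
     (\<forall>T\<subseteq>assumptions D. aba_closed D T \<and> aba_attacks D T {a} \<longrightarrow> aba_attacks D S T)"

definition aba_defends_set :: "'a abaf \<Rightarrow> 'a set \<Rightarrow> 'a set \<Rightarrow> bool" where
  "aba_defends_set D S T \<longleftrightarrow> (\<forall>a\<in>T. aba_defends D S a)"

definition aba_ad :: "'a abaf \<Rightarrow> 'a set set" where
  "aba_ad D = {S. S \<subseteq> assumptions D \<and> aba_conflict_free D S \<and>
     aba_closed D S \<and> aba_defends_set D S S}"

definition aba_pr :: "'a abaf \<Rightarrow> 'a set set" where
  "aba_pr D = {S \<in> aba_ad D. \<not> (\<exists>T\<in>aba_ad D. S \<subset> T)}"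

definition aba_co :: "'a abaf \<Rightarrow> 'a set set" where
  "aba_co D = {S \<in> aba_ad D. \<forall>T\<subseteq>assumptions D. aba_defends_set D S T \<longrightarrow> T \<subseteq> S}"

text \<open>There is no grounded extension when there is no complete one (rather than \<open>\<Inter>{} = UNIV\<close>).\<close>

definition aba_gr :: "'a abaf \<Rightarrow> 'a set set" where
  "aba_gr D = {S. S \<subseteq> assumptions D \<and> aba_conflict_free D S \<and>
     aba_co D \<noteq> {} \<and> S = \<Inter>(aba_co D)}"

definition aba_stb :: "'a abaf \<Rightarrow> 'a set set" where
  "aba_stb D = {S. S \<subseteq> assumptions D \<and> aba_conflict_free D S \<and>
     aba_closed D S \<and> (\<forall>x\<in>assumptions D - S. aba_attacks D S {x})}"

section \<open>Bipolar argumentation frameworks\<close>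

record 'b baf =
  args :: "'b set"
  att :: "('b \<times> 'b) set"
  supp :: "('b \<times> 'b) set"

definition bipolar_framework :: "'b baf \<Rightarrow> bool" where
  "bipolar_framework F \<longleftrightarrow> att F \<subseteq> args F \<times> args F \<and> supp F \<subseteq> args F \<times> args F"

definition baf_cl :: "'b baf \<Rightarrow> 'b set \<Rightarrow> 'b set" where
  "baf_cl F E = (supp F)\<^sup>* `` E"

definition baf_closed :: "'b baf \<Rightarrow> 'b set \<Rightarrow> bool" where
  "baf_closed F E \<longleftrightarrow> E = baf_cl F E"

definition baf_plus :: "'b baf \<Rightarrow> 'b set \<Rightarrow> 'b set" where
  "baf_plus F E = att F `` E"

definition baf_attacks :: "'b baf \<Rightarrow> 'b set \<Rightarrow> 'b set \<Rightarrow> bool" where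
  "baf_attacks F E X \<longleftrightarrow> (\<exists>a\<in>X. \<exists>e\<in>E. (e, a) \<in> att F)"

definition baf_conflict_free :: "'b baf \<Rightarrow> 'b set \<Rightarrow> bool" where
  "baf_conflict_free F E \<longleftrightarrow> E \<inter> baf_plus F E = {}"

definition baf_defends :: "'b baf \<Rightarrow> 'b set \<Rightarrow> 'b \<Rightarrow> bool" where
  "baf_defends F E a \<longleftrightarrow>
     (\<forall>X\<subseteq>args F. baf_closed F X \<and> baf_attacks F X {a} \<longrightarrow> baf_attacks F E X)"

definition baf_Gamma :: "'b baf \<Rightarrow> 'b set \<Rightarrow> 'b set" where
  "baf_Gamma F E = {a \<in> args F. baf_defends F E a}"

definition baf_ad :: "'b baf \<Rightarrow> 'b set set" where
  "baf_ad F = {E. E \<subseteq> args F \<and> baf_conflict_free F E \<and> baf_closed F E \<and> E \<subseteq> baf_Gamma F E}"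

section \<open>Premise-augmented bipolar argumentation frameworks\<close>

record ('b, 'p) pbaf =
  graph :: "'b baf"
  prem :: "'b \<Rightarrow> 'p set"

definition exhaustive :: "('b, 'p) pbaf \<Rightarrow> 'b set \<Rightarrow> bool" where
  "exhaustive P E \<longleftrightarrow>
     (\<forall>a\<in>args (graph P). prem P a \<subseteq> (\<Union>e\<in>E. prem P e) \<longrightarrow> a \<in> E)"

definition pbaf_ad :: "('b, 'p) pbaf \<Rightarrow> 'b set set" where
  "pbaf_ad P = {E. exhaustive P E \<and> E \<in> baf_ad (graph P)}"

definition pbaf_pr :: "('b, 'p) pbaf \<Rightarrow> 'b set set" where
  "pbaf_pr P = {E \<in> pbaf_ad P. \<not> (\<exists>X\<in>pbaf_ad P. E \<subset> X)}"

definition pbaf_co :: "('b, 'p) pbaf \<Rightarrow> 'b set set" where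
  "pbaf_co P = {E \<in> pbaf_ad P. E = baf_Gamma (graph P) E}"

definition pbaf_gr :: "('b, 'p) pbaf \<Rightarrow> 'b set set" where
  "pbaf_gr P = {E. E \<subseteq> args (graph P) \<and> baf_conflict_free (graph P) E \<and>
     pbaf_co P \<noteq> {} \<and> E = \<Inter>(pbaf_co P)}"

definition pbaf_stb :: "('b, 'p) pbaf \<Rightarrow> 'b set set" where
  "pbaf_stb P = {E. E \<subseteq> args (graph P) \<and> baf_conflict_free (graph P) E \<and>
     baf_closed (graph P) E \<and> baf_plus (graph P) E = args (graph P) - E}"

section \<open>Instantiation\<close>

text \<open>An argument \<open>S \<turnstile> p\<close> is the pair \<open>(S, p)\<close>.\<close>

type_synonym 'a arg = "'a set \<times> 'a"

definition asms :: "'a arg \<Rightarrow> 'a set" where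
  "asms x = fst x"

definition asms_set :: "'a arg set \<Rightarrow> 'a set" where
  "asms_set E = (\<Union>x\<in>E. asms x)"

definition aba_args :: "'a abaf \<Rightarrow> 'a arg set" where
  "aba_args D = {(S, p). derives D S p}"

definition inst_baf :: "'a abaf \<Rightarrow> 'a arg baf" where
  "inst_baf D =
     \<lparr> args = aba_args D,
       att = {((S, p), (T, q)). (S, p) \<in> aba_args D \<and> (T, q) \<in> aba_args D \<and> p \<in> contrary D ` T},
       supp = {((S, p), ({a}, a)) | S p a.
                (S, p) \<in> aba_args D \<and> ({a}, a) \<in> aba_args D \<and> a \<in> aba_cl D S} \<rparr>"

definition inst_pbaf :: "'a abaf \<Rightarrow> ('a arg, 'a) pbaf" where
  "inst_pbaf D = \<lparr> graph = inst_baf D, prem = asms \<rparr>"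

lemma bipolar_framework_inst_baf: "bipolar_framework (inst_baf D)"
  by (auto simp: bipolar_framework_def inst_baf_def)

section \<open>The five semantics\<close>

datatype semantics = Ad | Co | Pr | Gr | Stb

fun aba_extensions :: "semantics \<Rightarrow> 'a abaf \<Rightarrow> 'a set set" where
  "aba_extensions Ad = aba_ad"
| "aba_extensions Co = aba_co"
| "aba_extensions Pr = aba_pr"
| "aba_extensions Gr = aba_gr"
| "aba_extensions Stb = aba_stb"

fun pbaf_extensions :: "semantics \<Rightarrow> ('b, 'p) pbaf \<Rightarrow> 'b set set" where
  "pbaf_extensions Ad = pbaf_ad"
| "pbaf_extensions Co = pbaf_co"
| "pbaf_extensions Pr = pbaf_pr"
| "pbaf_extensions Gr = pbaf_gr"
| "pbaf_extensions Stb = pbaf_stb"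

end

(* On subsets S of the assumptions, S |-> {x. asms x <= S} is an order isomorphism onto the
   exhaustive sets of arguments, with inverse asms_set; it preserves and reflects attacks,
   closedness and defense. For defense, a closed set X of arguments attacking x contains an
   attacking argument (T, p), hence also all ({b}, b) with b in cl(T); as derivations compose,
   cl(T) is a closed set of assumptions, and any attack on it is an attack on X. Stable sets of
   arguments are exhaustive because an argument outside E with premises in asms(E) would be
   attacked at a premise of some member of E. *)
theory Submission
  imports Defs
begin

definition args_of :: "'a abaf \<Rightarrow> 'a set \<Rightarrow> 'a arg set" where
  "args_of D S = {x \<in> aba_args D. asms x \<subseteq> S}"

section \<open>Derivations\<close>

text \<open>Each leaf labelled \<open>Some b\<close> is replaced by its tree \<open>u\<close>, while
  leaves labelled \<open>None\<close> stay. Bounding the leaf labels by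
  \<open>insert None L\<close>, rather than prescribing them exactly, makes the bound pass from the
  subtrees to the whole tree.\<close>

lemma respects_rules_graft:
  assumes "respects_rules R t"
    and "\<And>b. Some b \<in> leaf_labels t \<Longrightarrow>
           \<exists>u. label u = Some b \<and> respects_rules R u \<and> leaf_labels u \<subseteq> insert None L"
  shows "\<exists>u. label u = label t \<and> respects_rules R u \<and> leaf_labels u \<subseteq> insert None L"
  using assms
proof (induction t)
  case (Node l ts)
  show ?case
  proof (cases "ts = []")
    case True
    show ?thesis
    proof (cases l)
      case None
      with True show ?thesis by (intro exI[of _ "Node None []"]) simp
    next
      case (Some b)
      with True Node.prems(2)[of b] show ?thesis by simp
    qed
  next
    case False
    have "\<forall>t\<in>set ts. \<exists>u. label u = label t \<and> respects_rules R u \<and> leaf_labels u \<subseteq> insert None L"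
    proof
      fix t assume t: "t \<in> set ts"
      show "\<exists>u. label u = label t \<and> respects_rules R u \<and> leaf_labels u \<subseteq> insert None L"
      proof (rule Node.IH[OF t])
        show "respects_rules R t" using Node.prems(1) t by simp
      next
        fix b assume "Some b \<in> leaf_labels t"
        then have "Some b \<in> leaf_labels (Node l ts)" using t False by auto
        then show "\<exists>u. label u = Some b \<and> respects_rules R u \<and> leaf_labels u \<subseteq> insert None L"
          by (rule Node.prems(2))
      qed
    qed
    then obtain f where f: "\<And>t. t \<in> set ts \<Longrightarrow>
        label (f t) = label t \<and> respects_rules R (f t) \<and> leaf_labels (f t) \<subseteq> insert None L"
      by metis
    \<comment> \<open>The rule condition at the root sees the children only through their labels,
      which grafting preserves.\<close>
    have lab: "map label (map f ts) = map label ts" using f by simp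
    have "respects_rules R (Node l (map f ts))"
      unfolding respects_rules.simps lab using Node.prems(1) f False by auto
    moreover have "leaf_labels (Node l (map f ts)) \<subseteq> insert None L"
      using f False by auto
    ultimately show ?thesis by (intro exI[of _ "Node l (map f ts)"]) simp
  qed
qed

text \<open>The exact leaf set demanded by \<open>derives\<close> becomes an upper bound, the form
  that grafting produces. From a tree within the bound, the witness \<open>S'\<close> is recovered
  as the set of all \<open>b\<close> with \<open>Some b\<close> at a leaf.\<close>

lemma Th_iff:
  "p \<in> Th D S \<longleftrightarrow> p \<in> sentences D \<and>
     (\<exists>t. label t = Some p \<and> respects_rules (rules D) t \<and>
          leaf_labels t \<subseteq> insert None (Some ` (S \<inter> assumptions D)))"
  (is "_ \<longleftrightarrow> ?R")
proof
  assume "p \<in> Th D S"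
  then obtain S' t where "S' \<subseteq> S" "S' \<subseteq> assumptions D" "p \<in> sentences D"
    "label t = Some p" "respects_rules (rules D) t"
    "leaf_labels t = Some ` S' \<or> leaf_labels t = Some ` S' \<union> {None}"
    unfolding Th_def derives_def by blast
  moreover from this have "leaf_labels t \<subseteq> insert None (Some ` (S \<inter> assumptions D))"
    by blast
  ultimately show ?R by blast
next
  assume ?R
  then obtain t where t: "p \<in> sentences D" "label t = Some p" "respects_rules (rules D) t"
    "leaf_labels t \<subseteq> insert None (Some ` (S \<inter> assumptions D))" by blast
  define S' where "S' = {b. Some b \<in> leaf_labels t}"
  have "x \<in> insert None (Some ` S')" if "x \<in> leaf_labels t" for x
    using that by (cases x) (auto simp: S'_def)
  then have "leaf_labels t = Some ` S' \<or> leaf_labels t = Some ` S' \<union> {None}"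
    by (auto simp: S'_def)
  moreover have "S' \<subseteq> S \<inter> assumptions D" using t(4) by (auto simp: S'_def)
  ultimately have "derives D S' p" "S' \<subseteq> S" using t(1-3) unfolding derives_def by auto
  then show "p \<in> Th D S" unfolding Th_def by blast
qed

lemma Th_mono: "S \<subseteq> T \<Longrightarrow> Th D S \<subseteq> Th D T"
  unfolding Th_def by blast

text \<open>Derivations compose: every leaf in \<open>aba_cl D S\<close> has its own derivation from
  \<open>S\<close>, which is grafted onto it.\<close>

lemma Th_cl: "Th D (aba_cl D S) \<subseteq> Th D S"
proof
  fix p assume "p \<in> Th D (aba_cl D S)"
  then obtain t where t: "p \<in> sentences D" "label t = Some p" "respects_rules (rules D) t"
    "leaf_labels t \<subseteq> insert None (Some ` (aba_cl D S \<inter> assumptions D))"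
    unfolding Th_iff by blast
  have "\<exists>u. label u = label t \<and> respects_rules (rules D) u \<and>
          leaf_labels u \<subseteq> insert None (Some ` (S \<inter> assumptions D))"
  proof (rule respects_rules_graft[OF t(3)])
    fix b assume "Some b \<in> leaf_labels t"
    then have "b \<in> Th D S" using t(4) by (auto simp: aba_cl_def)
    then show "\<exists>u. label u = Some b \<and> respects_rules (rules D) u \<and>
        leaf_labels u \<subseteq> insert None (Some ` (S \<inter> assumptions D))"
      unfolding Th_iff by blast
  qed
  then show "p \<in> Th D S" using t(1,2) unfolding Th_iff by auto
qed

lemma derives_assumption:
  assumes "aba_framework D" "a \<in> assumptions D"
  shows "derives D {a} a"
  using assms unfolding derives_def aba_framework_def
  by (auto intro: exI[of _ "Node (Some a) []"])

lemma derives_imp_Th: "derives D S p \<Longrightarrow> p \<in> Th D S"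
  unfolding Th_def by blast

lemma aba_cl_increasing:
  assumes "aba_framework D" "S \<subseteq> assumptions D"
  shows "S \<subseteq> aba_cl D S"
  using derives_assumption[OF assms(1)] assms(2) unfolding aba_cl_def Th_def by blast

lemma aba_closed_cl:
  assumes "aba_framework D"
  shows "aba_closed D (aba_cl D S)"
  unfolding aba_closed_def
  using aba_cl_increasing[OF assms, of "aba_cl D S"] Th_cl[of D S]
  by (auto simp: aba_cl_def)

section \<open>Assumption sets and argument sets\<close>

text \<open>The arguments \<open>({a}, a)\<close> are the probes by which \<open>S\<close> is read
  off \<open>args_of D S\<close>; they come from one-node trees.\<close>

lemma singleton_mem_args_of_iff:
  assumes "aba_framework D" "a \<in> assumptions D"
  shows "({a}, a) \<in> args_of D S \<longleftrightarrow> a \<in> S"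
  using derives_assumption[OF assms] by (simp add: args_of_def aba_args_def asms_def)

lemma asms_args_subset: "x \<in> aba_args D \<Longrightarrow> asms x \<subseteq> assumptions D"
  by (auto simp: aba_args_def asms_def derives_def)

lemma asms_set_args_of:
  assumes "aba_framework D" "S \<subseteq> assumptions D"
  shows "asms_set (args_of D S) = S"
proof
  show "asms_set (args_of D S) \<subseteq> S" by (auto simp: asms_set_def args_of_def)
  show "S \<subseteq> asms_set (args_of D S)"
  proof
    fix a assume "a \<in> S"
    then have "({a}, a) \<in> args_of D S"
      using singleton_mem_args_of_iff[OF assms(1)] assms(2) by blast
    then show "a \<in> asms_set (args_of D S)" unfolding asms_set_def by (force simp: asms_def)
  qed
qed

lemma asms_set_subset: "E \<subseteq> aba_args D \<Longrightarrow> asms_set E \<subseteq> assumptions D"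
  using asms_args_subset unfolding asms_set_def by blast

lemma args_of_subset_iff:
  assumes "aba_framework D" "S \<subseteq> assumptions D"
  shows "args_of D S \<subseteq> args_of D T \<longleftrightarrow> S \<subseteq> T"
proof
  assume "args_of D S \<subseteq> args_of D T"
  then show "S \<subseteq> T"
    using singleton_mem_args_of_iff[OF assms(1)] assms(2) by blast
qed (auto simp: args_of_def)

lemma args_inst [simp]: "args (inst_baf D) = aba_args D"
  by (simp add: inst_baf_def)

lemma graph_inst [simp]: "graph (inst_pbaf D) = inst_baf D"
  by (simp add: inst_pbaf_def)

text \<open>Since premises are \<open>asms\<close>, exhaustiveness is the inclusion of
  \<open>args_of D (asms_set E)\<close> in \<open>E\<close>; the reverse inclusion holds for every
  set of arguments.\<close>

lemma exhaustive_iff: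
  assumes "E \<subseteq> aba_args D"
  shows "exhaustive (inst_pbaf D) E \<longleftrightarrow> E = args_of D (asms_set E)"
  using assms by (auto simp: exhaustive_def inst_pbaf_def args_of_def asms_set_def)

lemma exhaustive_args_of:
  assumes "aba_framework D" "S \<subseteq> assumptions D"
  shows "exhaustive (inst_pbaf D) (args_of D S)"
  using exhaustive_iff[of "args_of D S" D] asms_set_args_of[OF assms]
  by (simp add: args_of_def)

section \<open>Attacks and conflict-freeness\<close>

text \<open>An attack hits a premise of its target, so only \<open>asms_set X\<close> matters. The
  target \<open>X\<close> is arbitrary because it is later also a singleton, or a closed set that
  may fail to be exhaustive.\<close>

lemma baf_attacks_args_of_iff:
  assumes "X \<subseteq> aba_args D"
  shows "baf_attacks (inst_baf D) (args_of D S) X \<longleftrightarrow> aba_attacks D S (asms_set X)"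
proof
  assume "baf_attacks (inst_baf D) (args_of D S) X"
  then obtain S' T q a where "(T, q) \<in> X" "(S', contrary D a) \<in> args_of D S" "a \<in> T"
    by (auto simp: baf_attacks_def inst_baf_def)
  moreover from this have "a \<in> asms_set X" by (force simp: asms_set_def asms_def)
  moreover have "contrary D a \<in> Th D S"
    using calculation by (auto simp: args_of_def aba_args_def asms_def Th_def)
  ultimately show "aba_attacks D S (asms_set X)" unfolding aba_attacks_def by blast
next
  assume "aba_attacks D S (asms_set X)"
  then obtain a T q S' where "(T, q) \<in> X" "a \<in> T" "S' \<subseteq> S" "derives D S' (contrary D a)"
    by (auto simp: aba_attacks_def asms_set_def asms_def Th_def)
  moreover from this have "((S', contrary D a), (T, q)) \<in> att (inst_baf D)"
    "(S', contrary D a) \<in> args_of D S"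
    using assms by (auto simp: inst_baf_def args_of_def aba_args_def asms_def)
  ultimately show "baf_attacks (inst_baf D) (args_of D S) X"
    unfolding baf_attacks_def by blast
qed

lemma baf_conflict_free_iff: "baf_conflict_free F E \<longleftrightarrow> \<not> baf_attacks F E E"
  by (auto simp: baf_conflict_free_def baf_plus_def baf_attacks_def)

lemma conflict_free_args_of_iff:
  assumes "aba_framework D" "S \<subseteq> assumptions D"
  shows "baf_conflict_free (inst_baf D) (args_of D S) \<longleftrightarrow> aba_conflict_free D S"
  using baf_attacks_args_of_iff[of "args_of D S" D S] asms_set_args_of[OF assms]
  by (simp add: baf_conflict_free_iff aba_conflict_free_def args_of_def)

section \<open>Closedness\<close>

lemma baf_closed_iff: "baf_closed F E \<longleftrightarrow> (\<forall>x y. x \<in> E \<longrightarrow> (x, y) \<in> supp F \<longrightarrow> y \<in> E)"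
proof
  assume "baf_closed F E"
  then show "\<forall>x y. x \<in> E \<longrightarrow> (x, y) \<in> supp F \<longrightarrow> y \<in> E"
    unfolding baf_closed_def baf_cl_def by blast
next
  assume step: "\<forall>x y. x \<in> E \<longrightarrow> (x, y) \<in> supp F \<longrightarrow> y \<in> E"
  have "y \<in> E" if "(x, y) \<in> (supp F)\<^sup>*" "x \<in> E" for x y
    using that by induction (use step in blast)+
  then show "baf_closed F E"
    unfolding baf_closed_def baf_cl_def by blast
qed

text \<open>Every assumption \<open>a\<close> has its argument \<open>({a}, a)\<close>, so the
  support edges out of \<open>x\<close> lead exactly to the \<open>({a}, a)\<close> with
  \<open>a\<close> in \<open>aba_cl D (asms x)\<close>.\<close>

lemma baf_closed_inst_iff:
  assumes "aba_framework D" "X \<subseteq> aba_args D"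
  shows "baf_closed (inst_baf D) X \<longleftrightarrow> (\<forall>x\<in>X. \<forall>a\<in>aba_cl D (asms x). ({a}, a) \<in> X)"
  unfolding baf_closed_iff using assms derives_assumption[OF assms(1)]
  by (fastforce simp: inst_baf_def asms_def aba_args_def aba_cl_def)

text \<open>An element of \<open>aba_cl D S\<close> is derived from some
  \<open>S' \<subseteq> S\<close>, and this derivation is itself an argument in
  \<open>args_of D S\<close>; so closing the single arguments already exhausts
  \<open>aba_cl D S\<close>.\<close>

lemma closed_args_of_iff:
  assumes "aba_framework D" "S \<subseteq> assumptions D"
  shows "baf_closed (inst_baf D) (args_of D S) \<longleftrightarrow> aba_closed D S"
proof -
  have "baf_closed (inst_baf D) (args_of D S) \<longleftrightarrow>
      (\<forall>x\<in>args_of D S. aba_cl D (asms x) \<subseteq> S)"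
    using baf_closed_inst_iff[OF assms(1), of "args_of D S"]
      singleton_mem_args_of_iff[OF assms(1), of _ S]
    by (auto simp: args_of_def aba_cl_def subset_iff)
  also have "\<dots> \<longleftrightarrow> aba_cl D S \<subseteq> S"
  proof
    assume H: "\<forall>x\<in>args_of D S. aba_cl D (asms x) \<subseteq> S"
    show "aba_cl D S \<subseteq> S"
    proof
      fix a assume "a \<in> aba_cl D S"
      then obtain S' where "S' \<subseteq> S" "derives D S' a" "a \<in> assumptions D"
        by (auto simp: aba_cl_def Th_def)
      moreover from this have "(S', a) \<in> args_of D S"
        by (simp add: args_of_def aba_args_def asms_def)
      moreover have "a \<in> aba_cl D S'"
        using calculation by (simp add: aba_cl_def derives_imp_Th)
      ultimately show "a \<in> S" using H by (force simp: asms_def)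
    qed
  next
    assume "aba_cl D S \<subseteq> S"
    moreover have "aba_cl D (asms x) \<subseteq> aba_cl D S" if "x \<in> args_of D S" for x
      using that Th_mono[of "asms x" S D] unfolding args_of_def aba_cl_def by blast
    ultimately show "\<forall>x\<in>args_of D S. aba_cl D (asms x) \<subseteq> S" by blast
  qed
  finally show ?thesis
    using aba_cl_increasing[OF assms] unfolding aba_closed_def by blast
qed

section \<open>Defense\<close>

lemma defends_args_of_iff:
  assumes D: "aba_framework D" and x: "x \<in> aba_args D"
  shows "baf_defends (inst_baf D) (args_of D S) x \<longleftrightarrow> aba_defends_set D S (asms x)"
proof
  assume def: "baf_defends (inst_baf D) (args_of D S) x"
  show "aba_defends_set D S (asms x)"
    unfolding aba_defends_set_def aba_defends_def
  proof (intro ballI allI impI)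
    fix a T
    assume a: "a \<in> asms x" and T: "T \<subseteq> assumptions D" "aba_closed D T \<and> aba_attacks D T {a}"
    \<comment> \<open>A closed \<open>T\<close> is tested through \<open>args_of D T\<close>, a
      closed set of arguments that attacks \<open>x\<close>.\<close>
    have "aba_attacks D T (asms_set {x})"
      using T a by (auto simp: aba_attacks_def asms_set_def)
    then have "baf_attacks (inst_baf D) (args_of D T) {x}"
      using baf_attacks_args_of_iff x by blast
    moreover have "baf_closed (inst_baf D) (args_of D T)"
      using closed_args_of_iff[OF D T(1)] T(2) by simp
    ultimately have "baf_attacks (inst_baf D) (args_of D S) (args_of D T)"
      using def by (simp add: baf_defends_def args_of_def)
    then show "aba_attacks D S T"
      using baf_attacks_args_of_iff[of "args_of D T" D S] asms_set_args_of[OF D T(1)]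
      by (simp add: args_of_def)
  qed
next
  assume def: "aba_defends_set D S (asms x)"
  show "baf_defends (inst_baf D) (args_of D S) x"
    unfolding baf_defends_def
  proof (intro allI impI)
    fix X
    assume "X \<subseteq> args (inst_baf D)" and X: "baf_closed (inst_baf D) X \<and> baf_attacks (inst_baf D) X {x}"
    then have XA: "X \<subseteq> aba_args D" by simp
    obtain T a where T: "(T, contrary D a) \<in> X" and a: "a \<in> asms x"
      using X by (auto simp: baf_attacks_def inst_baf_def asms_def)
    have dT: "derives D T (contrary D a)" using T XA by (auto simp: aba_args_def)
    then have TA: "T \<subseteq> assumptions D" by (simp add: derives_def)
    \<comment> \<open>\<open>T\<close> itself may fail to be closed, whereas the assumption
      \<open>def\<close> speaks of closed attackers only; hence the passage to
      \<open>aba_cl D T\<close>.\<close>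
    have "contrary D a \<in> Th D (aba_cl D T)"
      using derives_imp_Th[OF dT] Th_mono[OF aba_cl_increasing[OF D TA]] by blast
    then have "aba_attacks D S (aba_cl D T)"
      using def a aba_closed_cl[OF D, of T]
      by (simp add: aba_defends_set_def aba_defends_def aba_attacks_def aba_cl_def)
    \<comment> \<open>The support edges out of the attacker put \<open>({b}, b)\<close> into
      \<open>X\<close> for each \<open>b\<close> in \<open>aba_cl D T\<close>.\<close>
    moreover have "aba_cl D T \<subseteq> asms_set X"
      using baf_closed_inst_iff[OF D XA] X T by (force simp: asms_set_def asms_def)
    ultimately have "aba_attacks D S (asms_set X)" by (auto simp: aba_attacks_def)
    then show "baf_attacks (inst_baf D) (args_of D S) X"
      using baf_attacks_args_of_iff[OF XA] by simp
  qed
qed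

text \<open>An argument is defended iff all its premises are, so \<open>baf_Gamma\<close> sends sets
  of the form \<open>args_of D S\<close> to sets of the same form.\<close>

lemma Gamma_args_of:
  assumes "aba_framework D"
  shows "baf_Gamma (inst_baf D) (args_of D S) = args_of D {a \<in> assumptions D. aba_defends D S a}"
  using defends_args_of_iff[OF assms, of _ S] asms_args_subset[of _ D]
  by (auto simp: baf_Gamma_def args_of_def aba_defends_set_def subset_iff)

section \<open>Semantics\<close>

lemma args_of_mem_pbaf_ad_iff:
  assumes "aba_framework D" "S \<subseteq> assumptions D"
  shows "args_of D S \<in> pbaf_ad (inst_pbaf D) \<longleftrightarrow> S \<in> aba_ad D"
proof -
  have "args_of D S \<subseteq> baf_Gamma (inst_baf D) (args_of D S) \<longleftrightarrow> aba_defends_set D S S"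
    unfolding Gamma_args_of[OF assms(1)] args_of_subset_iff[OF assms]
    using assms(2) by (auto simp: aba_defends_set_def)
  then show ?thesis
    using assms(2) exhaustive_args_of[OF assms] conflict_free_args_of_iff[OF assms]
      closed_args_of_iff[OF assms]
    by (auto simp: pbaf_ad_def baf_ad_def aba_ad_def args_of_def)
qed

text \<open>Exhaustiveness is part of \<open>pbaf_ad\<close>, so every member has the form
  \<open>args_of D S\<close> and the equivalence for such sets covers all cases.\<close>

lemma pbaf_ad_eq:
  assumes "aba_framework D"
  shows "pbaf_ad (inst_pbaf D) = args_of D ` aba_ad D"
proof (intro equalityI subsetI)
  fix E assume E: "E \<in> pbaf_ad (inst_pbaf D)"
  then have EA: "E \<subseteq> aba_args D" and ex: "exhaustive (inst_pbaf D) E"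
    by (simp_all add: pbaf_ad_def baf_ad_def)
  have "E = args_of D (asms_set E)" using exhaustive_iff[OF EA] ex by blast
  moreover from this have "asms_set E \<in> aba_ad D"
    using E args_of_mem_pbaf_ad_iff[OF assms asms_set_subset[OF EA]] by simp
  ultimately show "E \<in> args_of D ` aba_ad D" by (rule image_eqI)
next
  fix E assume "E \<in> args_of D ` aba_ad D"
  then show "E \<in> pbaf_ad (inst_pbaf D)"
    using args_of_mem_pbaf_ad_iff[OF assms] by (auto simp: aba_ad_def)
qed

lemma pbaf_pr_eq:
  assumes "aba_framework D"
  shows "pbaf_pr (inst_pbaf D) = args_of D ` aba_pr D"
proof -
  have iff: "args_of D S \<subset> args_of D T \<longleftrightarrow> S \<subset> T" if "S \<in> aba_ad D" "T \<in> aba_ad D" for S T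
    using that args_of_subset_iff[OF assms] by (simp add: aba_ad_def less_le_not_le)
  show ?thesis
  proof (intro equalityI subsetI)
    fix E assume "E \<in> pbaf_pr (inst_pbaf D)"
    then obtain S where S: "S \<in> aba_ad D" "E = args_of D S"
      and max: "\<forall>T\<in>aba_ad D. \<not> args_of D S \<subset> args_of D T"
      by (auto simp only: pbaf_pr_def pbaf_ad_eq[OF assms] image_iff mem_Collect_eq bex_simps)
    then have "S \<in> aba_pr D" by (simp add: aba_pr_def iff)
    with S show "E \<in> args_of D ` aba_pr D" by blast
  next
    fix E assume "E \<in> args_of D ` aba_pr D"
    then obtain S where "S \<in> aba_ad D" "E = args_of D S" "\<forall>T\<in>aba_ad D. \<not> S \<subset> T"
      unfolding aba_pr_def by blast
    then show "E \<in> pbaf_pr (inst_pbaf D)"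
      by (simp add: pbaf_pr_def pbaf_ad_eq[OF assms] iff)
  qed
qed

section \<open>Complete and grounded extensions\<close>

text \<open>Admissibility gives \<open>S \<subseteq> ?G\<close>, which leaves
  \<open>?G \<subseteq> S\<close>. As \<open>?G\<close> is the largest assumption set defended by
  \<open>S\<close>, this bounds all defended sets at once.\<close>

lemma args_of_fixpoint_iff:
  assumes "aba_framework D" "S \<in> aba_ad D"
  shows "args_of D S = baf_Gamma (inst_baf D) (args_of D S) \<longleftrightarrow>
    (\<forall>T\<subseteq>assumptions D. aba_defends_set D S T \<longrightarrow> T \<subseteq> S)"
proof -
  let ?G = "{a \<in> assumptions D. aba_defends D S a}"
  have "S \<subseteq> assumptions D" and "S \<subseteq> ?G"
    using assms(2) by (auto simp: aba_ad_def aba_defends_set_def)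
  then have "args_of D S = args_of D ?G \<longleftrightarrow> ?G \<subseteq> S"
    using args_of_subset_iff[OF assms(1), of S ?G] args_of_subset_iff[OF assms(1), of ?G S]
    by auto
  also have "\<dots> \<longleftrightarrow> (\<forall>T\<subseteq>assumptions D. aba_defends_set D S T \<longrightarrow> T \<subseteq> S)"
    unfolding aba_defends_set_def by blast
  finally show ?thesis unfolding Gamma_args_of[OF assms(1)] .
qed

lemma pbaf_co_eq:
  assumes "aba_framework D"
  shows "pbaf_co (inst_pbaf D) = args_of D ` aba_co D"
  using args_of_fixpoint_iff[OF assms]
  by (auto simp: pbaf_co_def aba_co_def pbaf_ad_eq[OF assms])

text \<open>For empty \<open>C\<close> the left side is \<open>UNIV\<close> while the right side is
  \<open>aba_args D\<close>.\<close>

lemma args_of_Inter: "C \<noteq> {} \<Longrightarrow> \<Inter>(args_of D ` C) = args_of D (\<Inter>C)"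
  by (auto simp: args_of_def)

text \<open>Without complete extensions both sides are empty. Otherwise each side has the
  intersection as its only candidate, and the candidates correspond by
  \<open>args_of_Inter\<close>.\<close>

lemma pbaf_gr_eq:
  assumes "aba_framework D"
  shows "pbaf_gr (inst_pbaf D) = args_of D ` aba_gr D"
proof (cases "aba_co D = {}")
  case True
  then show ?thesis by (simp add: pbaf_gr_def aba_gr_def pbaf_co_eq[OF assms])
next
  case False
  then obtain S where "S \<in> aba_co D" by blast
  then have "\<Inter>(aba_co D) \<subseteq> assumptions D"
    unfolding aba_co_def aba_ad_def by blast
  moreover from this have "baf_conflict_free (inst_baf D) (args_of D (\<Inter>(aba_co D))) \<longleftrightarrow>
      aba_conflict_free D (\<Inter>(aba_co D))"
    by (rule conflict_free_args_of_iff[OF assms])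
  moreover have "args_of D (\<Inter>(aba_co D)) \<subseteq> aba_args D" by (simp add: args_of_def)
  ultimately show ?thesis
    using False by (auto simp: pbaf_gr_def aba_gr_def pbaf_co_eq[OF assms] args_of_Inter)
qed

section \<open>Stable extensions\<close>

lemma plus_args_of:
  "baf_plus (inst_baf D) (args_of D S) = {x \<in> aba_args D. aba_attacks D S (asms x)}"
proof -
  have "x \<in> baf_plus (inst_baf D) (args_of D S) \<longleftrightarrow> aba_attacks D S (asms x)"
    if "x \<in> aba_args D" for x
    using baf_attacks_args_of_iff[of "{x}" D S] that
    by (simp add: baf_plus_def baf_attacks_def asms_set_def Image_iff)
  moreover have "baf_plus (inst_baf D) (args_of D S) \<subseteq> aba_args D"
    by (auto simp: baf_plus_def inst_baf_def)
  ultimately show ?thesis by blast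
qed

lemma args_of_mem_pbaf_stb_iff:
  assumes D: "aba_framework D" and S: "S \<subseteq> assumptions D"
  shows "args_of D S \<in> pbaf_stb (inst_pbaf D) \<longleftrightarrow> S \<in> aba_stb D"
proof -
  \<comment> \<open>Both stable semantics include conflict-freeness. Under it, an argument attacked
    by \<open>S\<close> has a premise outside \<open>S\<close>, as the backward direction requires;
    the forward direction tests the arguments \<open>({a}, a)\<close>.\<close>
  have "baf_plus (inst_baf D) (args_of D S) = aba_args D - args_of D S \<longleftrightarrow>
      (\<forall>a\<in>assumptions D - S. aba_attacks D S {a})"
    if cf: "aba_conflict_free D S"
  proof
    assume eq: "baf_plus (inst_baf D) (args_of D S) = aba_args D - args_of D S"
    show "\<forall>a\<in>assumptions D - S. aba_attacks D S {a}"
    proof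
      fix a assume a: "a \<in> assumptions D - S"
      then have "({a}, a) \<in> aba_args D - args_of D S"
        using derives_assumption[OF D] by (simp add: aba_args_def args_of_def asms_def)
      then show "aba_attacks D S {a}"
        unfolding eq[symmetric] plus_args_of by (simp add: asms_def)
    qed
  next
    assume H: "\<forall>a\<in>assumptions D - S. aba_attacks D S {a}"
    have "aba_attacks D S (asms x) \<longleftrightarrow> \<not> asms x \<subseteq> S" if "x \<in> aba_args D" for x
      using asms_args_subset[OF that] H cf
      by (fastforce simp: aba_attacks_def aba_conflict_free_def)
    then show "baf_plus (inst_baf D) (args_of D S) = aba_args D - args_of D S"
      unfolding plus_args_of by (auto simp: args_of_def)
  qed
  moreover have "args_of D S \<subseteq> aba_args D" by (simp add: args_of_def)
  ultimately show ?thesis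
    using S conflict_free_args_of_iff[OF D S] closed_args_of_iff[OF D S]
    by (auto simp: pbaf_stb_def aba_stb_def)
qed

text \<open>The definition of \<open>pbaf_stb\<close> does not ask for exhaustiveness, so it has to
  be derived before \<open>E\<close> can be written as
  \<open>args_of D (asms_set E)\<close>.\<close>

lemma exhaustive_stable:
  assumes "E \<in> pbaf_stb (inst_pbaf D)"
  shows "exhaustive (inst_pbaf D) E"
proof -
  have EA: "E \<subseteq> aba_args D" and cf: "E \<inter> baf_plus (inst_baf D) E = {}"
    and pl: "baf_plus (inst_baf D) E = aba_args D - E"
    using assms by (auto simp: pbaf_stb_def baf_conflict_free_def)
  have "x \<in> E" if x: "x \<in> aba_args D" "asms x \<subseteq> asms_set E" for x
  proof (rule ccontr)
    assume "x \<notin> E"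
    then have "x \<in> baf_plus (inst_baf D) E" using pl x by simp
    then obtain T a where T: "(T, contrary D a) \<in> E" and a: "a \<in> asms x"
      by (auto simp: baf_plus_def inst_baf_def asms_def)
    \<comment> \<open>The attack on \<open>x\<close> at the premise \<open>a\<close> equally hits
      any \<open>y\<close> in \<open>E\<close> sharing that premise.\<close>
    then obtain y where y: "y \<in> E" "a \<in> asms y" using x by (auto simp: asms_set_def)
    then have "((T, contrary D a), y) \<in> att (inst_baf D)"
      using T EA by (cases y) (auto simp: inst_baf_def asms_def)
    then show False using T y(1) cf by (auto simp: baf_plus_def)
  qed
  then show ?thesis
    unfolding exhaustive_iff[OF EA] using EA by (auto simp: args_of_def asms_set_def)
qed

lemma pbaf_stb_eq:
  assumes "aba_framework D"
  shows "pbaf_stb (inst_pbaf D) = args_of D ` aba_stb D"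
proof (intro equalityI subsetI)
  fix E assume E: "E \<in> pbaf_stb (inst_pbaf D)"
  then have EA: "E \<subseteq> aba_args D" by (simp add: pbaf_stb_def)
  have "E = args_of D (asms_set E)"
    using exhaustive_iff[OF EA] exhaustive_stable[OF E] by blast
  moreover from this have "asms_set E \<in> aba_stb D"
    using E args_of_mem_pbaf_stb_iff[OF assms asms_set_subset[OF EA]] by simp
  ultimately show "E \<in> args_of D ` aba_stb D" by (rule image_eqI)
next
  fix E assume "E \<in> args_of D ` aba_stb D"
  then show "E \<in> pbaf_stb (inst_pbaf D)"
    using args_of_mem_pbaf_stb_iff[OF assms] by (auto simp: aba_stb_def)
qed

text \<open>One image equation serves both halves: (ii) is membership in the image, and (i) follows
  since \<open>asms_set\<close> inverts \<open>args_of D\<close> on assumption sets.\<close>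

lemma pbaf_extensions_eq:
  assumes "aba_framework D"
  shows "pbaf_extensions \<sigma> (inst_pbaf D) = args_of D ` aba_extensions \<sigma> D"
  by (cases \<sigma>) (simp_all add: assms pbaf_ad_eq pbaf_co_eq pbaf_pr_eq pbaf_gr_eq pbaf_stb_eq)

lemma aba_gr_mem_subset: "S \<in> aba_gr D \<Longrightarrow> S \<subseteq> assumptions D"
  unfolding aba_gr_def by blast

lemma aba_extensions_subset: "S \<in> aba_extensions \<sigma> D \<Longrightarrow> S \<subseteq> assumptions D"
  by (cases \<sigma>)
     (simp_all add: aba_ad_def aba_co_def aba_pr_def aba_stb_def aba_gr_mem_subset)

theorem theorem5p7:
  fixes D :: "'a abaf" and \<sigma> :: semantics
  assumes "aba_framework D"
  shows "(\<forall>E. E \<in> pbaf_extensions \<sigma> (inst_pbaf D) \<longrightarrow> asms_set E \<in> aba_extensions \<sigma> D) \<and>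
         (\<forall>S. S \<in> aba_extensions \<sigma> D \<longrightarrow> {x \<in> aba_args D. asms x \<subseteq> S} \<in> pbaf_extensions \<sigma> (inst_pbaf D))"
  unfolding pbaf_extensions_eq[OF assms] args_of_def[symmetric]
  using asms_set_args_of[OF assms aba_extensions_subset] by auto

end
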